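(* Let $p=q=1/2$ and let $X_{n,s}$ be the number of turns required to end the single-player pile game with boundary with set of choices $R=\{1,-1\}$ and target $n$, starting with $s$ chips, $0\le s\le n$. Then $$E[X_{n,s}^2]=\frac{(n-s)(n+s+1)(5n^2+5n-s^2-s-1)}{3},$$ $$E[X_{n,s}^3]=\frac{(n-s)(n+s+1)}{15}\Bigl(61n^4+122n^3-(14s^2+14s-38)n^2-(14s^2+14s+23)n+s^4+2s^3+8s^2+7s-3\Bigr).$$
   Context: Single-player pile game with boundary, $R=\{1,-1\}$: the player starts with $s$ chips, $0\le s\le n$. In each turn, independently, with probability $p$ one chip is added, and with probability $q=1-p$ one chip is removed, except that if the player has $0$ chips he stays at $0$ instead. The game ends when the player first has $n$ chips (at turn $0$ if $s=n$). *)

theory Defs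
  imports "HOL-Probability.Probability"
begin

text \<open>The choice made in turn \<open>k\<close> (counting from 0) is an integer-valued random variable.\<close>

locale pile_game = prob_space M
  for M :: "'a measure" +
  fixes p :: real and choice :: "nat \<Rightarrow> 'a \<Rightarrow> int"
  assumes indep_choice: "indep_vars (\<lambda>_. count_space UNIV) choice UNIV"
    and prob_add: "\<And>k. prob {\<omega> \<in> space M. choice k \<omega> = 1} = p"
    and prob_remove: "\<And>k. prob {\<omega> \<in> space M. choice k \<omega> = - 1} = 1 - p"

text \<open>The pile is let run on after the target is reached; this does not affect the first
  time at which it is reached.\<close>

primrec chips :: "(nat \<Rightarrow> 'a \<Rightarrow> int) \<Rightarrow> nat \<Rightarrow> nat \<Rightarrow> 'a \<Rightarrow> int" where
  "chips choice s 0 \<omega> = int s"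
| "chips choice s (Suc k) \<omega> =
    (if chips choice s k \<omega> = 0 \<and> choice k \<omega> = - 1 then 0
     else chips choice s k \<omega> + choice k \<omega>)"

text \<open>The number of turns, with value \<open>\<infinity>\<close> (the infimum of the empty set) if the
  game never ends.\<close>

definition turns :: "(nat \<Rightarrow> 'a \<Rightarrow> int) \<Rightarrow> nat \<Rightarrow> nat \<Rightarrow> 'a \<Rightarrow> enat" where
  "turns choice n s \<omega> = Inf {enat k | k. chips choice s k \<omega> = int n}"

end

theory Submission
  imports Defs
begin

text \<open>Let T(j) be the number of turns from j chips. After one turn the game restarts from j'
  chips, so T(j) is distributed as 1 + T(j'). Expanding (1 + T(j'))^q shows that the moments h_q
  should satisfy h_q(j) = 1 + sum over 0 < i \<le> q of binom(q,i) times the average of h_i over the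
  two values of j', with h_q(n) = 0. In the variables n(n+1) and j(j+1), the stated polynomials
  solve this system (\<open>moment_recurrence\<close>).

  To see that the solution really is the moment, whose finiteness is not known beforehand, put
  u(k,j) = sum of binom(q,i) k^(q-i) h_i(j) with h_0 = 1, which stands for the mean of (k + T(j))^q
  (\<open>moment_step\<close>). By \<open>expectation_running_step\<close> this gives a martingale
  when stopped: for every k, the mean of u over the games still running at time k, plus the sum over
  i \<le> k of i^q P(T = i), equals u(0,s). Since u \<ge> k^q, the series converges, so k^q P(T > k)
  tends to 0; since u \<le> C k^q, the running part then vanishes in the limit. This is
  \<open>moment_turns\<close>; \<open>nn_integral_turns_power\<close> identifies the series with the
  integral.\<close>

section \<open>The pile as a function of finitely many choices\<close>

lemma measurable_chips:
  assumes "\<And>i. i < k \<Longrightarrow> c i \<in> measurable N (count_space UNIV)"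
  shows "chips c s k \<in> measurable N (count_space UNIV)"
  using assms
proof (induction k)
  case 0
  have "chips c s 0 = (\<lambda>\<omega>. int s)" by auto
  then show ?case by simp
next
  case (Suc k)
  have "(\<lambda>\<omega>. (\<lambda>j \<omega>. if j = 0 \<and> c k \<omega> = - 1 then 0 else j + c k \<omega>) (chips c s k \<omega>) \<omega>)
      \<in> measurable N (count_space UNIV)"
  \<comment> \<open>The pile takes values in the countable type \<open>int\<close>, so its value can
    be frozen to a constant \<open>j\<close> while the last choice varies.\<close>
  proof (rule measurable_compose_countable[where f = "\<lambda>j \<omega>. if j = 0 \<and> c k \<omega> = - 1 then 0 else j + c k \<omega>"])
    show "chips c s k \<in> measurable N (count_space UNIV)"
      using Suc by simp
    show "(\<lambda>\<omega>. if j = 0 \<and> c k \<omega> = - 1 then 0 else j + c k \<omega>) \<in> measurable N (count_space UNIV)" for j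
      by (rule measurable_compose[where g = "\<lambda>x. if j = 0 \<and> x = - 1 then 0 else j + x"])
        (use Suc.prems in auto)
  qed
  also have "(\<lambda>\<omega>. (\<lambda>j \<omega>. if j = 0 \<and> c k \<omega> = - 1 then 0 else j + c k \<omega>) (chips c s k \<omega>) \<omega>)
      = chips c s (Suc k)"
    by auto
  finally show ?case .
qed

text \<open>The pile after at most \<open>k\<close> turns only looks at the first \<open>k\<close>
  choices. Writing it as a function of that block of choices is what lets independence of blocks
  apply.\<close>

lemma chips_restrict:
  "m \<le> k \<Longrightarrow> chips (\<lambda>i x. x i) s m (\<lambda>i\<in>{..<k}. c i \<omega>) = chips c s m \<omega>"
  by (induction m) auto

section \<open>The first time at which the target is reached\<close>

text \<open>The event T > k for the number of turns T, phrased through the path so that it is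
  visibly determined by the first \<open>k\<close> choices.\<close>

definition running :: "(nat \<Rightarrow> 'a \<Rightarrow> int) \<Rightarrow> nat \<Rightarrow> nat \<Rightarrow> nat \<Rightarrow> 'a \<Rightarrow> bool" where
  "running c n s k \<omega> \<longleftrightarrow> (\<forall>i\<le>k. chips c s i \<omega> \<noteq> int n)"

lemma running_0: "running c n s 0 \<omega> \<longleftrightarrow> s \<noteq> n"
  by (simp add: running_def)

lemma running_Suc:
  "running c n s (Suc k) \<omega> \<longleftrightarrow> running c n s k \<omega> \<and> chips c s (Suc k) \<omega> \<noteq> int n"
  unfolding running_def by (auto simp: le_Suc_eq simp del: chips.simps)

text \<open>The event T = k, by \<open>turns_ends_at\<close>; it is always finitely determined,
  whereas \<open>turns\<close> may be infinite.\<close>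

definition ends_at :: "(nat \<Rightarrow> 'a \<Rightarrow> int) \<Rightarrow> nat \<Rightarrow> nat \<Rightarrow> nat \<Rightarrow> 'a \<Rightarrow> bool" where
  "ends_at c n s k \<omega> \<longleftrightarrow> (\<forall>i<k. chips c s i \<omega> \<noteq> int n) \<and> chips c s k \<omega> = int n"

lemma ends_at_Suc:
  "ends_at c n s (Suc k) \<omega> \<longleftrightarrow> running c n s k \<omega> \<and> chips c s (Suc k) \<omega> = int n"
  unfolding running_def ends_at_def by (simp only: less_Suc_eq_le)

lemma measurable_running:
  assumes "\<And>i. i < k \<Longrightarrow> c i \<in> measurable N (count_space UNIV)"
  shows "Measurable.pred N (running c n s k)"
proof -
  have [measurable]: "chips c s i \<in> measurable N (count_space UNIV)" if "i \<in> {..k}" for i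
    using assms that by (intro measurable_chips) auto
  have "Measurable.pred N (\<lambda>\<omega>. \<forall>i\<in>{..k}. chips c s i \<omega> \<noteq> int n)"
    by measurable
  then show ?thesis
    by (simp add: running_def[abs_def] Ball_def)
qed

lemma turns_ends_at:
  assumes "ends_at c n s k \<omega>"
  shows "turns c n s \<omega> = enat k"
  unfolding turns_def
proof (rule Inf_eqI)
  show "enat k \<le> i" if "i \<in> {enat k |k. chips c s k \<omega> = int n}" for i
    using that assms unfolding ends_at_def by (auto simp: not_less[symmetric])
  show "y \<le> enat k" if "\<And>i. i \<in> {enat k |k. chips c s k \<omega> = int n} \<Longrightarrow> y \<le> i" for y
    using that assms unfolding ends_at_def by auto
qed

lemma ends_at_if_not_running:
  assumes "\<not> running c n s k \<omega>"
  shows "\<exists>i\<le>k. ends_at c n s i \<omega>"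
proof -
  define i where "i = (LEAST i. chips c s i \<omega> = int n)"
  obtain j where "j \<le> k" "chips c s j \<omega> = int n"
    using assms by (auto simp: running_def)
  then have "i \<le> k" "ends_at c n s i \<omega>"
    unfolding i_def ends_at_def
    by (auto intro: Least_le order_trans LeastI dest: not_less_Least)
  then show ?thesis by blast
qed

lemma ends_at_unique:
  "ends_at c n s i \<omega> \<Longrightarrow> ends_at c n s j \<omega> \<Longrightarrow> i = j"
  by (metis enat.inject turns_ends_at)

section \<open>Almost sure behaviour of the game\<close>

context pile_game
begin

lemma measurable_choice [measurable]: "choice k \<in> measurable M (count_space UNIV)"
  using indep_choice by (simp add: indep_vars_def)

lemma measurable_chips_choice [measurable]: "chips choice s k \<in> measurable M (count_space UNIV)"
  by (rule measurable_chips) simp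

lemma measurable_running_choice [measurable]: "Measurable.pred M (running choice n s k)"
  by (rule measurable_running) simp

lemma measurable_ends_at [measurable]: "Measurable.pred M (ends_at choice n s k)"
  unfolding ends_at_def[abs_def] by measurable

lemma AE_choice: "AE \<omega> in M. \<forall>k. choice k \<omega> = 1 \<or> choice k \<omega> = - 1"
  unfolding AE_all_countable
proof
  fix k
  have "prob {\<omega> \<in> space M. choice k \<omega> = 1 \<or> choice k \<omega> = - 1} =
      prob ({\<omega> \<in> space M. choice k \<omega> = 1} \<union> {\<omega> \<in> space M. choice k \<omega> = - 1})"
    by (rule arg_cong[where f = prob]) auto
  also have "\<dots> = 1"
    using prob_add[of k] prob_remove[of k] by (subst finite_measure_Union) auto
  finally show "AE \<omega> in M. choice k \<omega> = 1 \<or> choice k \<omega> = - 1"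
    by (subst (asm) prob_Collect_eq_1) auto
qed

text \<open>A pile that moves by at most one chip per turn cannot pass \<open>n\<close> without
  meeting it, and the rule at 0 keeps it nonnegative. This is only almost sure, since
  \<open>choice\<close> may take other integer values on a null set.\<close>

lemma AE_chips_bounds:
  assumes "s \<le> n"
  shows "AE \<omega> in M. running choice n s k \<omega> \<longrightarrow> 0 \<le> chips choice s k \<omega> \<and> chips choice s k \<omega> < int n"
  using AE_choice
proof eventually_elim
  case (elim \<omega>)
  show ?case
  proof (induction k)
    case 0
    then show ?case using assms by (auto simp: running_def)
  next
    case (Suc k)
    then show ?case using elim[rule_format, of k] by (auto simp: running_Suc)
  qed
qed

section \<open>Independence from the past and the expectation after one turn\<close>

text \<open>While the game runs, the pile almost surely has only the finitely many values 0, ..., n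
  - 1, so any \<open>F\<close> is bounded there.\<close>

lemma integrable_running:
  fixes F :: "int \<Rightarrow> real"
  assumes "s \<le> n"
  shows "integrable M (\<lambda>\<omega>. if running choice n s k \<omega> then F (chips choice s k \<omega>) else 0)"
proof (rule integrable_const_bound)
  have le: "\<bar>F j\<bar> \<le> (\<Sum>j\<in>{0..<int n}. \<bar>F j\<bar>)" if "j \<in> {0..<int n}" for j
    using that by (intro member_le_sum) auto
  show "AE \<omega> in M. norm (if running choice n s k \<omega> then F (chips choice s k \<omega>) else 0)
      \<le> (\<Sum>j\<in>{0..<int n}. \<bar>F j\<bar>)"
    using AE_chips_bounds[OF assms, of k] by eventually_elim (auto intro: le sum_nonneg)
qed measurable

text \<open>The state of the game up to turn \<open>k\<close> depends only on the choices before turn \<open>k\<close>,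
  so it is independent of the choice made in turn \<open>k\<close>.\<close>

lemma expectation_running_choice:
  fixes F :: "int \<Rightarrow> real"
  assumes "s \<le> n"
  shows "expectation (\<lambda>\<omega>. (if running choice n s k \<omega> then F (chips choice s k \<omega>) else 0)
        * (if choice k \<omega> = d then 1 else 0))
    = expectation (\<lambda>\<omega>. if running choice n s k \<omega> then F (chips choice s k \<omega>) else 0)
        * prob {\<omega> \<in> space M. choice k \<omega> = d}"
    (is "expectation (\<lambda>\<omega>. ?X \<omega> * ?Y \<omega>) = _")
    and "integrable M (\<lambda>\<omega>. (if running choice n s k \<omega> then F (chips choice s k \<omega>) else 0)
        * (if choice k \<omega> = d then 1 else 0))"
proof -
  let ?P = "\<lambda>A. PiM A (\<lambda>_::nat. count_space (UNIV :: int set))"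
  let ?c = "\<lambda>i (x :: nat \<Rightarrow> int). x i"
  let ?f = "\<lambda>x. if running ?c n s k x then F (chips ?c s k x) else 0"
  let ?g = "\<lambda>x. (if x k = d then 1 else 0) :: real"
  have c: "?c i \<in> measurable (?P {..<k}) (count_space UNIV)" if "i < k" for i
    using that by (intro measurable_component_singleton) auto
  have [measurable]: "chips ?c s k \<in> measurable (?P {..<k}) (count_space UNIV)"
    "Measurable.pred (?P {..<k}) (running ?c n s k)"
    by (intro measurable_chips measurable_running c; assumption)+
  have f: "?f \<in> borel_measurable (?P {..<k})"
    by measurable
  have [measurable]: "(\<lambda>x. x k) \<in> measurable (?P {k}) (count_space UNIV)"
    by (intro measurable_component_singleton) auto
  have g: "?g \<in> borel_measurable (?P {k})"
    by measurable
  \<comment> \<open>The index sets \<open>{..<k}\<close> and \<open>{k}\<close> are disjoint;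
    \<open>?f\<close> replays the game from the first block alone.\<close>
  have "indep_var (?P {..<k}) (\<lambda>\<omega>. \<lambda>i\<in>{..<k}. choice i \<omega>) (?P {k}) (\<lambda>\<omega>. \<lambda>i\<in>{k}. choice i \<omega>)"
    by (rule indep_var_restrict[OF indep_choice]) auto
  then have "indep_var borel (?f \<circ> (\<lambda>\<omega>. \<lambda>i\<in>{..<k}. choice i \<omega>)) borel (?g \<circ> (\<lambda>\<omega>. \<lambda>i\<in>{k}. choice i \<omega>))"
    using f g by (rule indep_var_compose)
  also have "?f \<circ> (\<lambda>\<omega>. \<lambda>i\<in>{..<k}. choice i \<omega>) = ?X"
    by (auto simp: fun_eq_iff running_def chips_restrict)
  also have "?g \<circ> (\<lambda>\<omega>. \<lambda>i\<in>{k}. choice i \<omega>) = ?Y"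
    by (auto simp: fun_eq_iff)
  finally have ind: "indep_var borel ?X borel ?Y" .
  have Y: "?Y \<in> borel_measurable M"
    by measurable
  have intY: "integrable M ?Y"
    by (rule integrable_const_bound[where B = 1]) (use Y in auto)
  have "expectation ?Y = expectation (indicator {\<omega> \<in> space M. choice k \<omega> = d})"
    by (intro Bochner_Integration.integral_cong) (auto simp: indicator_def)
  then have eY: "expectation ?Y = prob {\<omega> \<in> space M. choice k \<omega> = d}"
    by simp
  show "expectation (\<lambda>\<omega>. ?X \<omega> * ?Y \<omega>) = expectation ?X * prob {\<omega> \<in> space M. choice k \<omega> = d}"
    using indep_var_lebesgue_integral[OF ind integrable_running[OF assms] intY] eY by simp
  show "integrable M (\<lambda>\<omega>. ?X \<omega> * ?Y \<omega>)"
    by (rule indep_var_integrable[OF ind integrable_running[OF assms] intY])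
qed

text \<open>The Markov property in integrated form: given the past, the choice in turn
  \<open>k\<close> is still 1 or -1 with probabilities \<open>p\<close> and \<open>1 - p\<close>, so
  it can be averaged out.\<close>

lemma expectation_running_step:
  fixes F :: "int \<Rightarrow> real"
  assumes "s \<le> n"
  shows "expectation (\<lambda>\<omega>. if running choice n s k \<omega> then F (chips choice s (Suc k) \<omega>) else 0)
    = expectation (\<lambda>\<omega>. if running choice n s k \<omega>
        then p * F (chips choice s k \<omega> + 1)
          + (1 - p) * F (if chips choice s k \<omega> = 0 then 0 else chips choice s k \<omega> - 1) else 0)"
    (is "expectation ?L = expectation ?R")
proof -
  let ?F1 = "\<lambda>j. F (j + 1)" and ?F2 = "\<lambda>j. F (if j = 0 then 0 else j - 1)"
  let ?X = "\<lambda>F \<omega>. if running choice n s k \<omega> then F (chips choice s k \<omega>) else (0::real)"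
  let ?Y = "\<lambda>d \<omega>. if choice k \<omega> = d then 1 else (0::real)"
  note E = expectation_running_choice[OF assms, of k]
  \<comment> \<open>Other values of the choice have probability 0; a removal from an empty pile
    leaves it at 0, as \<open>?F2\<close> records.\<close>
  have L: "AE \<omega> in M. ?L \<omega> = ?X ?F1 \<omega> * ?Y 1 \<omega> + ?X ?F2 \<omega> * ?Y (- 1) \<omega>"
    using AE_choice
  proof eventually_elim
    case (elim \<omega>)
    then show ?case using elim[rule_format, of k] by auto
  qed
  have int: "integrable M (\<lambda>\<omega>. ?X ?F1 \<omega> * ?Y 1 \<omega> + ?X ?F2 \<omega> * ?Y (- 1) \<omega>)"
    by (intro Bochner_Integration.integrable_add E(2))
  have meas: "?L \<in> borel_measurable M"
    by (simp del: chips.simps)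
  have "expectation ?L = expectation (\<lambda>\<omega>. ?X ?F1 \<omega> * ?Y 1 \<omega> + ?X ?F2 \<omega> * ?Y (- 1) \<omega>)"
    using meas _ L by (rule integral_cong_AE) (use int in auto)
  also have "\<dots> = expectation (?X ?F1) * p + expectation (?X ?F2) * (1 - p)"
    using E[of ?F1 1] E[of ?F2 "- 1"]
    by (subst Bochner_Integration.integral_add) (simp_all only: prob_add prob_remove)
  also have "\<dots> = expectation (\<lambda>\<omega>. p * ?X ?F1 \<omega> + (1 - p) * ?X ?F2 \<omega>)"
    using integrable_running[OF assms, of k ?F1] integrable_running[OF assms, of k ?F2]
    by (subst Bochner_Integration.integral_add) (simp_all add: mult.commute)
  also have "\<dots> = expectation ?R"
    by (intro Bochner_Integration.integral_cong) auto
  finally show "expectation ?L = expectation ?R" .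
qed


section \<open>Moments as series, and optional stopping\<close>

lemma prob_running_Suc:
  "prob {\<omega> \<in> space M. running choice n s k \<omega>}
    = prob {\<omega> \<in> space M. running choice n s (Suc k) \<omega>} + prob {\<omega> \<in> space M. ends_at choice n s (Suc k) \<omega>}"
proof -
  have "{\<omega> \<in> space M. running choice n s k \<omega>}
      = {\<omega> \<in> space M. running choice n s (Suc k) \<omega>} \<union> {\<omega> \<in> space M. ends_at choice n s (Suc k) \<omega>}"
    unfolding running_Suc ends_at_Suc by blast
  then show ?thesis
    by (auto simp: running_Suc ends_at_Suc simp del: chips.simps intro!: finite_measure_Union)
qed

text \<open>By \<open>lim\<close> the game ends almost surely, so T^q is almost surely the sum over
  i of i^q times the indicator of T = i; a series of nonnegative functions may be integrated term by
  term.\<close>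

lemma nn_integral_turns_power:
  assumes "q > 0"
    and lim: "(\<lambda>k. prob {\<omega> \<in> space M. running choice n s k \<omega>}) \<longlonglongrightarrow> 0"
    and sums: "(\<lambda>i. real i ^ q * prob {\<omega> \<in> space M. ends_at choice n s i \<omega>}) sums L"
  shows "(\<integral>\<^sup>+\<omega>. ennreal_of_enat (turns choice n s \<omega>) ^ q \<partial>M) = ennreal L"
proof -
  have "prob {\<omega> \<in> space M. \<forall>k. running choice n s k \<omega>} \<le> prob {\<omega> \<in> space M. running choice n s k \<omega>}" for k
    by (intro finite_measure_mono) auto
  then have "prob {\<omega> \<in> space M. \<forall>k. running choice n s k \<omega>} \<le> 0"
    by (intro LIMSEQ_le_const[OF lim]) auto
  then have "prob {\<omega> \<in> space M. \<forall>k. running choice n s k \<omega>} = 0"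
    by (simp add: order_antisym)
  then have AE_end: "AE \<omega> in M. \<not> (\<forall>k. running choice n s k \<omega>)"
    by (subst (asm) prob_Collect_eq_0) auto
  have "(\<integral>\<^sup>+\<omega>. ennreal_of_enat (turns choice n s \<omega>) ^ q \<partial>M)
      = (\<integral>\<^sup>+\<omega>. (\<Sum>i. ennreal (real i ^ q) * indicator {\<omega> \<in> space M. ends_at choice n s i \<omega>} \<omega>) \<partial>M)"
  proof (intro nn_integral_cong_AE)
    show "AE \<omega> in M. ennreal_of_enat (turns choice n s \<omega>) ^ q
        = (\<Sum>i. ennreal (real i ^ q) * indicator {\<omega> \<in> space M. ends_at choice n s i \<omega>} \<omega>)"
      using AE_end AE_space
    proof eventually_elim
      case (elim \<omega>)
      then obtain k where "\<not> running choice n s k \<omega>"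
        by blast
      then obtain k where k: "ends_at choice n s k \<omega>"
        by (metis ends_at_if_not_running)
      have "(\<Sum>i. ennreal (real i ^ q) * indicator {\<omega> \<in> space M. ends_at choice n s i \<omega>} \<omega>)
          = (\<Sum>i\<in>{k}. ennreal (real i ^ q) * indicator {\<omega> \<in> space M. ends_at choice n s i \<omega>} \<omega>)"
        using ends_at_unique[OF k] by (intro suminf_finite) (auto simp: indicator_def)
      then show ?case
        using k elim turns_ends_at[OF k]
        by (simp add: ennreal_power[symmetric] ennreal_of_nat_eq_real_of_nat)
    qed
  qed
  also have "\<dots> = (\<Sum>i. ennreal (real i ^ q * prob {\<omega> \<in> space M. ends_at choice n s i \<omega>}))"
    by (subst nn_integral_suminf)
      (auto simp: nn_integral_cmult_indicator emeasure_eq_measure ennreal_mult)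
  also have "\<dots> = ennreal L"
    using sums by (intro suminf_ennreal_eq) auto
  finally show ?thesis .
qed

text \<open>Optional stopping: \<open>u (min k T) (chips (min k T))\<close> is a martingale, where \<open>T\<close> is the number of
  turns. In applications, \<open>u k j\<close> is the \<open>q\<close>-th moment of \<open>k\<close> plus the number of turns needed from
  \<open>j\<close> chips. The lower bound on \<open>u\<close> alone forces \<open>T\<close> to have a finite \<open>q\<close>-th moment, which in
  turn makes the contribution of the games still running at time \<open>k\<close> vanish in the limit.\<close>

lemma moment_turns:
  fixes u :: "nat \<Rightarrow> int \<Rightarrow> real"
  assumes "s \<le> n" and q: "q > 0"
    and boundary: "\<And>k. u k (int n) = real k ^ q"
    and harmonic: "\<And>k j. 0 \<le> j \<Longrightarrow> j < int n \<Longrightarrow>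
      u k j = p * u (Suc k) (j + 1) + (1 - p) * u (Suc k) (if j = 0 then 0 else j - 1)"
    and lower: "\<And>k j. 0 \<le> j \<Longrightarrow> j < int n \<Longrightarrow> real k ^ q \<le> u k j"
    and upper: "\<And>k j. 0 \<le> j \<Longrightarrow> j < int n \<Longrightarrow> 0 < k \<Longrightarrow> u k j \<le> u 1 j * real k ^ q"
  shows "(\<integral>\<^sup>+\<omega>. ennreal_of_enat (turns choice n s \<omega>) ^ q \<partial>M) = ennreal (u 0 (int s))"
proof -
  define r where "r k = expectation (\<lambda>\<omega>. if running choice n s k \<omega> then u k (chips choice s k \<omega>) else 0)" for k
  define a where "a k = prob {\<omega> \<in> space M. running choice n s k \<omega>}" for k
  define b where "b k = prob {\<omega> \<in> space M. ends_at choice n s k \<omega>}" for k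
  \<comment> \<open>A bound for \<open>u 1\<close> on all states of a running game; a sum, unlike a
    maximum, also makes sense when there are none.\<close>
  define C where "C = (\<Sum>j\<in>{0..<int n}. \<bar>u 1 j\<bar>)"
  \<comment> \<open>The term \<open>i = k\<close> is included: \<open>S k\<close> accounts for games
    ended by time \<open>k\<close>, \<open>r k\<close> for the others.\<close>
  define S where "S k = (\<Sum>i<Suc k. real i ^ q * b i)" for k
  note int = integrable_running[OF \<open>s \<le> n\<close>]

  have r_S: "r k + S k = u 0 (int s)" for k
  proof (induction k)
    case 0
    \<comment> \<open>Since \<open>q > 0\<close>, the term \<open>i = 0\<close> of \<open>S\<close>
      vanishes, as does \<open>u 0 (int n)\<close> when \<open>s = n\<close>.\<close>
    show ?case
      using q boundary[of 0] by (cases "s = n") (simp_all add: r_def S_def running_0 prob_space)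
  next
    case (Suc k)
    have "r k = expectation (\<lambda>\<omega>. if running choice n s k \<omega>
        then p * u (Suc k) (chips choice s k \<omega> + 1)
          + (1 - p) * u (Suc k) (if chips choice s k \<omega> = 0 then 0 else chips choice s k \<omega> - 1) else 0)"
      unfolding r_def using AE_chips_bounds[OF \<open>s \<le> n\<close>, of k]
      by (intro integral_cong_AE) (auto elim!: eventually_mono simp: harmonic[of _ k])
    also have "\<dots> = expectation (\<lambda>\<omega>. if running choice n s k \<omega> then u (Suc k) (chips choice s (Suc k) \<omega>) else 0)"
      by (rule expectation_running_step[OF \<open>s \<le> n\<close>, symmetric])
    \<comment> \<open>After the turn the game either still runs or has just ended; in the second
      case \<open>boundary\<close> evaluates \<open>u\<close>.\<close>
    also have "\<dots> = expectation (\<lambda>\<omega>.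
        (if running choice n s (Suc k) \<omega> then u (Suc k) (chips choice s (Suc k) \<omega>) else 0)
        + real (Suc k) ^ q * indicator {\<omega> \<in> space M. ends_at choice n s (Suc k) \<omega>} \<omega>)"
      by (intro Bochner_Integration.integral_cong)
        (auto simp: running_Suc ends_at_Suc boundary simp del: chips.simps)
    also have "\<dots> = r (Suc k) + real (Suc k) ^ q * b (Suc k)"
      unfolding r_def b_def using int[of "Suc k" "u (Suc k)"]
      by (subst Bochner_Integration.integral_add) (auto simp: emeasure_eq_measure simp del: chips.simps)
    finally show ?case
      using Suc by (simp add: S_def)
  qed

  have a_expectation: "c * a k = expectation (\<lambda>\<omega>. if running choice n s k \<omega> then c else 0)" for c k
  proof -
    have "expectation (\<lambda>\<omega>. if running choice n s k \<omega> then c else 0)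
        = expectation (\<lambda>\<omega>. c * indicator {\<omega> \<in> space M. running choice n s k \<omega>} \<omega>)"
      by (intro Bochner_Integration.integral_cong) auto
    then show ?thesis by (simp add: a_def)
  qed
  have r_lower: "real k ^ q * a k \<le> r k" for k
    unfolding a_expectation r_def using AE_chips_bounds[OF \<open>s \<le> n\<close>, of k]
    by (intro integral_mono_AE int[of k "\<lambda>_. _"] int) (auto elim!: eventually_mono intro: lower)
  have upper': "u k j \<le> C * real k ^ q" if "0 \<le> j" "j < int n" "0 < k" for k j
  proof -
    have "\<bar>u 1 j\<bar> \<le> C"
      unfolding C_def using that by (intro member_le_sum) auto
    then have "u 1 j * real k ^ q \<le> C * real k ^ q"
      by (intro mult_right_mono) auto
    then show ?thesis
      using upper[OF that] by linarith
  qed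
  have r_upper: "r k \<le> C * real k ^ q * a k" if "0 < k" for k
    unfolding a_expectation r_def using AE_chips_bounds[OF \<open>s \<le> n\<close>, of k]
    by (intro integral_mono_AE int[of k "\<lambda>_. _"] int) (auto elim!: eventually_mono intro: upper' that)

  have nonneg: "0 \<le> a k" "0 \<le> b k" for k
    by (simp_all add: a_def b_def)
  have r_nonneg: "0 \<le> r k" for k
    using r_lower[of k] nonneg(1)[of k] by (meson mult_nonneg_nonneg of_nat_0_le_iff order_trans zero_le_power)
  have S_nonneg: "0 \<le> S k" for k
    by (simp add: S_def sum_nonneg nonneg)
  have "(\<lambda>i. real i ^ q * b i) sums (\<Sum>i. real i ^ q * b i)"
  proof (rule summable_sums, rule summableI_nonneg_bounded)
    show "(\<Sum>i<k. real i ^ q * b i) \<le> u 0 (int s)" for k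
    proof -
      have "(\<Sum>i<k. real i ^ q * b i) \<le> S k"
        by (simp add: S_def nonneg)
      then show ?thesis
        using r_S[of k] r_nonneg[of k] by linarith
    qed
  qed (simp add: nonneg)
  then obtain L where L: "(\<lambda>i. real i ^ q * b i) sums L"
    by blast
  have S_lim: "S \<longlonglongrightarrow> L"
    unfolding S_def[abs_def] using L by (subst filterlim_sequentially_Suc) (simp add: sums_def)
  have S_le: "S k \<le> L" for k
    unfolding S_def using L by (metis (no_types, lifting) sum_le_suminf sums_iff finite_lessThan nonneg(2) mult_nonneg_nonneg of_nat_0_le_iff zero_le_power)

  \<comment> \<open>Markov's inequality: k P(T > k) \<le> k^q P(T > k) \<le> \<open>r k\<close>,
    which is at most \<open>u 0 (int s)\<close>.\<close>
  have a_lim: "a \<longlonglongrightarrow> 0"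
  proof (rule tendsto_sandwich[where f = "\<lambda>_. 0"])
    show "\<forall>\<^sub>F k in sequentially. a k \<le> u 0 (int s) / real k"
      using eventually_gt_at_top[of 0]
    proof eventually_elim
      case (elim k)
      have "real k * a k \<le> real k ^ q * a k"
        using elim q nonneg by (intro mult_right_mono self_le_power) auto
      also have "\<dots> \<le> u 0 (int s)"
        using r_lower[of k] r_S[of k] S_nonneg[of k] by linarith
      finally show ?case
        using elim by (simp add: field_simps)
    qed
    show "(\<lambda>k. u 0 (int s) / real k) \<longlonglongrightarrow> 0"
      by (rule lim_const_over_n)
  qed (auto simp: nonneg)

  \<comment> \<open>On k < T \<le> k + m one has k^q \<le> T^q, so k^q P(k < T \<le> k + m) is at
    most the corresponding block of the series; then m tends to infinity.\<close>
  have tail: "real k ^ q * a k \<le> L - S k" for k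
  proof -
    have step: "real k ^ q * (a k - a (k + m)) \<le> S (k + m) - S k" for m
    proof (induction m)
      case (Suc m)
      have "a (k + m) = a (k + Suc m) + b (k + Suc m)"
        using prob_running_Suc[of n s "k + m"] by (simp only: a_def b_def add_Suc_right)
      moreover have "real k ^ q * b (k + Suc m) \<le> real (k + Suc m) ^ q * b (k + Suc m)"
        by (intro mult_right_mono power_mono nonneg) auto
      moreover have "S (k + Suc m) = S (k + m) + real (k + Suc m) ^ q * b (k + Suc m)"
        by (simp add: S_def)
      ultimately show ?case
        using Suc by (simp add: algebra_simps)
    qed simp
    have "(\<lambda>m. real k ^ q * (a k - a (k + m))) \<longlonglongrightarrow> real k ^ q * (a k - 0)"
      using LIMSEQ_ignore_initial_segment[OF a_lim, of k]
      by (intro tendsto_intros) (simp add: add.commute)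
    then have "real k ^ q * (a k - 0) \<le> L - S k"
    proof (rule LIMSEQ_le_const2)
      show "\<exists>N. \<forall>m\<ge>N. real k ^ q * (a k - a (k + m)) \<le> L - S k"
        using step S_le by (meson diff_right_mono order_trans)
    qed
    then show ?thesis by simp
  qed
  have tail_lim: "(\<lambda>k. real k ^ q * a k) \<longlonglongrightarrow> 0"
  proof (rule tendsto_sandwich[where f = "\<lambda>_. 0"])
    show "(\<lambda>k. L - S k) \<longlonglongrightarrow> 0"
      using tendsto_diff[OF tendsto_const S_lim, of L] by simp
  qed (auto simp: nonneg tail)
  \<comment> \<open>Squeezed between 0 and \<open>C\<close> times the vanishing tail: the running
    games contribute nothing in the limit.\<close>
  have "r \<longlonglongrightarrow> 0"
  proof (rule tendsto_sandwich[where f = "\<lambda>_. 0"])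
    show "(\<lambda>k. C * real k ^ q * a k) \<longlonglongrightarrow> 0"
      using tendsto_mult_left[OF tail_lim, of C] by (simp add: mult.assoc)
    show "\<forall>\<^sub>F k in sequentially. r k \<le> C * real k ^ q * a k"
      using eventually_gt_at_top[of 0] by eventually_elim (rule r_upper)
  qed (auto simp: r_nonneg)
  then have "(\<lambda>k. r k + S k) \<longlonglongrightarrow> 0 + L"
    using S_lim by (rule tendsto_add)
  then have "L = u 0 (int s)"
    by (simp add: r_S LIMSEQ_const_iff)
  then show ?thesis
    using nn_integral_turns_power[OF q a_lim[unfolded a_def[abs_def]] L[unfolded b_def]] by simp
qed

end

section \<open>Closed forms for the moments and their recurrences\<close>

text \<open>The first three moments of the number of turns from \<open>j\<close> chips, written in the variables
  \<open>n (n + 1)\<close> and \<open>j (j + 1)\<close>. Invariance under \<open>j \<mapsto> - 1 - j\<close> takes care of the boundary: staying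
  at \<open>0\<close> amounts to a step from \<open>0\<close> to \<open>- 1\<close>.\<close>

definition moment1 :: "real \<Rightarrow> real \<Rightarrow> real" where
  "moment1 N S = N - S"

definition moment2 :: "real \<Rightarrow> real \<Rightarrow> real" where
  "moment2 N S = (N - S) * (5 * N - S - 1) / 3"

definition moment3 :: "real \<Rightarrow> real \<Rightarrow> real" where
  "moment3 N S = (N - S) * (61 * N ^ 2 - 14 * S * N + S ^ 2 - 23 * N + 7 * S - 3) / 15"

text \<open>The second factor is at least 4N - 1 for the second moment and at least 47N^2 - 23N - 3
  for the third, both by S \<le> N. In the game, N \<ge> 2 amounts to n \<ge> 1, which holds
  whenever some pile is below the target.\<close>

lemma moment_nonneg:
  assumes "0 \<le> S" "S \<le> N" "2 \<le> N"
  shows "0 \<le> moment1 N S" "0 \<le> moment2 N S" "0 \<le> moment3 N S"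
proof -
  show "0 \<le> moment1 N S"
    using assms by (simp add: moment1_def)
  show "0 \<le> moment2 N S"
    using assms by (simp add: moment2_def)
  have "S * N \<le> N ^ 2"
    using assms by (simp add: power2_eq_square mult_right_mono)
  moreover have "2 * N \<le> N ^ 2"
    using assms by (simp add: power2_eq_square mult_right_mono)
  moreover have "0 \<le> S ^ 2"
    by simp
  ultimately have "0 \<le> 61 * N ^ 2 - 14 * (S * N) + S ^ 2 - 23 * N + 7 * S - 3"
    using assms by linarith
  then show "0 \<le> moment3 N S"
    using assms by (simp add: moment3_def mult.assoc)
qed

text \<open>x(x+1) is symmetric about -1/2, so it agrees at 0 and at -1, the point that an
  unrestricted step down from 0 would reach. Hence the recurrences need no separate case at the
  boundary.\<close>

lemma reflected_step:
  "of_int (if j = 0 then 0 else j - 1) * (of_int (if j = 0 then 0 else j - 1) + 1) = of_int j * (of_int j - (1::real))"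
  by auto

text \<open>First-step analysis: the coefficients 1, 2, 1 and 1, 3, 3, 1 come from (1 + T')^q with
  T' the number of turns left after one turn. For the closed forms these are polynomial identities
  in x.\<close>

lemma moment_recurrence:
  fixes x :: real
  shows "moment1 N (x * (x + 1)) = 1 + (moment1 N ((x + 1) * (x + 2)) + moment1 N (x * (x - 1))) / 2"
    and "moment2 N (x * (x + 1)) = 1
      + 2 * ((moment1 N ((x + 1) * (x + 2)) + moment1 N (x * (x - 1))) / 2)
      + (moment2 N ((x + 1) * (x + 2)) + moment2 N (x * (x - 1))) / 2"
    and "moment3 N (x * (x + 1)) = 1
      + 3 * ((moment1 N ((x + 1) * (x + 2)) + moment1 N (x * (x - 1))) / 2)
      + 3 * ((moment2 N ((x + 1) * (x + 2)) + moment2 N (x * (x - 1))) / 2)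
      + (moment3 N ((x + 1) * (x + 2)) + moment3 N (x * (x - 1))) / 2"
  unfolding moment1_def moment2_def moment3_def by (simp_all add: field_simps power2_eq_square)

text \<open>With h, a, b the moments from the present pile and from the piles after an addition and
  a removal, this compares the expansions of (k + T)^q and ((1 + k) + T')^q, giving the harmonicity
  that \<open>moment_turns\<close> asks for.\<close>

lemma moment_step:
  fixes k :: real
  assumes "h1 = 1 + (a1 + b1) / 2"
    and "h2 = 1 + 2 * ((a1 + b1) / 2) + (a2 + b2) / 2"
    and "h3 = 1 + 3 * ((a1 + b1) / 2) + 3 * ((a2 + b2) / 2) + (a3 + b3) / 2"
  shows "k ^ 2 + 2 * k * h1 + h2
      = 1 / 2 * ((1 + k) ^ 2 + 2 * (1 + k) * a1 + a2) + (1 - 1 / 2) * ((1 + k) ^ 2 + 2 * (1 + k) * b1 + b2)"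
    and "k ^ 3 + 3 * k ^ 2 * h1 + 3 * k * h2 + h3
      = 1 / 2 * ((1 + k) ^ 3 + 3 * (1 + k) ^ 2 * a1 + 3 * (1 + k) * a2 + a3)
        + (1 - 1 / 2) * ((1 + k) ^ 3 + 3 * (1 + k) ^ 2 * b1 + 3 * (1 + k) * b2 + b3)"
  unfolding assms by (simp_all add: power2_eq_square power3_eq_cube field_simps)

theorem proposition5:
  fixes M :: "'a measure" and choice :: "nat \<Rightarrow> 'a \<Rightarrow> int" and n s :: nat
  assumes "pile_game M (1/2) choice"
    and "s \<le> n"
  shows "(\<integral>\<^sup>+\<omega>. ennreal_of_enat (turns choice n s \<omega>) ^ 2 \<partial>M) =
      ennreal ((real n - real s) * (real n + real s + 1) *
        (5 * real n ^ 2 + 5 * real n - real s ^ 2 - real s - 1) / 3) \<and>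
    (\<integral>\<^sup>+\<omega>. ennreal_of_enat (turns choice n s \<omega>) ^ 3 \<partial>M) =
      ennreal ((real n - real s) * (real n + real s + 1) / 15 *
        (61 * real n ^ 4 + 122 * real n ^ 3
         - (14 * real s ^ 2 + 14 * real s - 38) * real n ^ 2
         - (14 * real s ^ 2 + 14 * real s + 23) * real n
         + real s ^ 4 + 2 * real s ^ 3 + 8 * real s ^ 2 + 7 * real s - 3))"
proof -
  interpret pile_game M "1/2" choice by (rule assms(1))
  define N where "N = real n * (real n + 1)"
  define h1 where "h1 j = moment1 N (of_int j * (of_int j + 1))" for j :: int
  define h2 where "h2 j = moment2 N (of_int j * (of_int j + 1))" for j :: int
  define h3 where "h3 j = moment3 N (of_int j * (of_int j + 1))" for j :: int
  define d where "d j = (if j = 0 then 0 else j - 1)" for j :: int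
  define u2 where "u2 k j = real k ^ 2 + 2 * real k * h1 j + h2 j" for k j
  define u3 where "u3 k j = real k ^ 3 + 3 * real k ^ 2 * h1 j + 3 * real k * h2 j + h3 j" for k j

  have up: "of_int (j + 1) * (of_int (j + 1) + 1) = (of_int j + 1) * (of_int j + (2 :: real))" for j :: int
    by simp
  have h1: "h1 j = 1 + (h1 (j + 1) + h1 (d j)) / 2" for j
    unfolding h1_def d_def up reflected_step by (rule moment_recurrence(1))
  have h2: "h2 j = 1 + 2 * ((h1 (j + 1) + h1 (d j)) / 2) + (h2 (j + 1) + h2 (d j)) / 2" for j
    unfolding h1_def h2_def d_def up reflected_step by (rule moment_recurrence(2))
  have h3: "h3 j = 1 + 3 * ((h1 (j + 1) + h1 (d j)) / 2) + 3 * ((h2 (j + 1) + h2 (d j)) / 2)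
      + (h3 (j + 1) + h3 (d j)) / 2" for j
    unfolding h1_def h2_def h3_def d_def up reflected_step by (rule moment_recurrence(3))
  have boundary: "h1 (int n) = 0" "h2 (int n) = 0" "h3 (int n) = 0"
    by (simp_all add: h1_def h2_def h3_def moment1_def moment2_def moment3_def N_def)
  have nonneg: "0 \<le> h1 j" "0 \<le> h2 j" "0 \<le> h3 j" if "0 \<le> j" "j < int n" for j
  proof -
    have n: "real_of_int j \<le> real n" "1 \<le> real n"
      using that by linarith+
    then have "0 \<le> real_of_int j * (real_of_int j + 1)" "real_of_int j * (real_of_int j + 1) \<le> N"
      using that unfolding N_def by (auto intro!: mult_mono)
    moreover have "2 \<le> N"
      unfolding N_def using mult_mono[of 1 "real n" 2 "real n + 1"] n by simp
    ultimately show "0 \<le> h1 j" "0 \<le> h2 j" "0 \<le> h3 j"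
      unfolding h1_def h2_def h3_def by (simp_all add: moment_nonneg)
  qed

  have "(\<integral>\<^sup>+\<omega>. ennreal_of_enat (turns choice n s \<omega>) ^ 2 \<partial>M) = ennreal (u2 0 (int s))"
  proof (rule moment_turns[OF assms(2)])
    fix k j assume j: "0 \<le> j" "j < int n"
    show "u2 k j = 1 / 2 * u2 (Suc k) (j + 1) + (1 - 1 / 2) * u2 (Suc k) (if j = 0 then 0 else j - 1)"
      unfolding d_def[symmetric] u2_def of_nat_Suc by (rule moment_step(1)[OF h1 h2 h3])
    show "real k ^ 2 \<le> u2 k j"
      using nonneg[OF j] by (simp add: u2_def)
    show "u2 k j \<le> u2 1 j * real k ^ 2" if "0 < k"
    proof -
      \<comment> \<open>For k \<ge> 1 each power of k in \<open>u2 k j\<close> is at most k^2, and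
        \<open>u2 1 j\<close> is the sum of the coefficients.\<close>
      have "real k * h1 j \<le> real k ^ 2 * h1 j" "1 * h2 j \<le> real k ^ 2 * h2 j"
        using that nonneg[OF j] by (intro mult_right_mono; simp add: self_le_power)+
      then show ?thesis
        by (simp add: u2_def algebra_simps)
    qed
  qed (simp_all add: u2_def boundary)
  moreover have "(\<integral>\<^sup>+\<omega>. ennreal_of_enat (turns choice n s \<omega>) ^ 3 \<partial>M) = ennreal (u3 0 (int s))"
  proof (rule moment_turns[OF assms(2)])
    fix k j assume j: "0 \<le> j" "j < int n"
    show "u3 k j = 1 / 2 * u3 (Suc k) (j + 1) + (1 - 1 / 2) * u3 (Suc k) (if j = 0 then 0 else j - 1)"
      unfolding d_def[symmetric] u3_def of_nat_Suc by (rule moment_step(2)[OF h1 h2 h3])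
    show "real k ^ 3 \<le> u3 k j"
      using nonneg[OF j] by (simp add: u3_def)
    show "u3 k j \<le> u3 1 j * real k ^ 3" if "0 < k"
    proof -
      have "real k ^ 2 * h1 j \<le> real k ^ 3 * h1 j" "real k * h2 j \<le> real k ^ 3 * h2 j"
        "1 * h3 j \<le> real k ^ 3 * h3 j"
        using that nonneg[OF j] by (intro mult_right_mono; simp add: self_le_power power_increasing)+
      then show ?thesis
        by (simp add: u3_def algebra_simps)
    qed
  qed (simp_all add: u3_def boundary)
  \<comment> \<open>At k = 0 only \<open>h2\<close> survives, and n(n+1) - s(s+1) =
    (n-s)(n+s+1).\<close>
  moreover have "u2 0 (int s) = (real n - real s) * (real n + real s + 1) *
      (5 * real n ^ 2 + 5 * real n - real s ^ 2 - real s - 1) / 3"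
    unfolding u2_def h2_def moment2_def N_def by (simp add: field_simps power2_eq_square)
  moreover have "u3 0 (int s) = (real n - real s) * (real n + real s + 1) / 15 *
      (61 * real n ^ 4 + 122 * real n ^ 3
       - (14 * real s ^ 2 + 14 * real s - 38) * real n ^ 2
       - (14 * real s ^ 2 + 14 * real s + 23) * real n
       + real s ^ 4 + 2 * real s ^ 3 + 8 * real s ^ 2 + 7 * real s - 3)"
    unfolding u3_def h3_def moment3_def N_def
    by (simp add: field_simps power2_eq_square power3_eq_cube power4_eq_xxxx)
  ultimately show ?thesis by simp
qed

end
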